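(* Let $n>2$, let $G=\mathrm{UT}(n,\mathbb{F}_q)$, let $\lambda$ be a nondegenerate character of the associative algebra $\mathfrak{g}_+$, let $S,S'\subset\Pi$, $a\in\Lambda_S$, $a'\in\Lambda_{S'}$. Then the linear forms $\lambda_{S,a}$ and $\lambda_{S',a'}$ lie in a common coadjoint ($\mathrm{Ad}_G^*$-) orbit in $\mathfrak{g}^*$ if and only if they coincide.
   Context: Let $\mathbb{F}_q$ be a finite field with $q$ elements (arbitrary characteristic), $n>2$. $\mathfrak{g}$ is the associative algebra of strictly upper triangular $n\times n$ matrices over $\mathbb{F}_q$, $E$ is the identity matrix, and $G=\mathrm{UT}(n,\mathbb{F}_q)=E+\mathfrak{g}$ acts on $\mathfrak{g}^*$ by the coadjoint action. A root is a pair $(i,j)$ with $1\le i<j\le n$; $R$ is the set of roots and $E_{(i,j)}=E_{ij}$ is the matrix unit. Put $R_+=\{(i,j)\in R: i+j<n+1\}$, $R_0=\{(i,j)\in R: i+j=n+1\}$, $R_-=\{(i,j)\in R: i+j>n+1\}$, and $\mathfrak{g}_+=\mathrm{span}\{E_\alpha:\alpha\in R_+\}$, a subalgebra of $\mathfrak g$. Let $k=[\frac{n-1}{2}]$, $\Pi_0=\{(i,i+1):1\le i\le k\}$, $\Pi=\{(i,n-i):1\le i\le k\}$. A character of an associative algebra $\mathfrak{a}$ is a linear form on $\mathfrak{a}$ vanishing on $\mathfrak{a}^2$. A character $\lambda:\mathfrak{g}_+\to\mathbb{F}_q$ is nondegenerate if $\lambda(E_\gamma)\neq0$ for all $\gamma\in\Pi\setminus\Pi_0$.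 A root $(i,j)$ is viewed as a box in row $i$ and column $j$ of an $n\times n$ matrix. For $S\subset\Pi$ define: - $L_S^0$: all roots $\gamma=(i,j)$ such that (i) $1\le i\le k$ and $i+j\ge n+1$, (ii) there is no root of $S$ in the $i$th row and none in the $j$th column, and (iii) all roots of $\Pi$ lying strictly above and strictly to the left of $\gamma$ belong to $S$. - $L_S^{00}$: empty if $n$ is odd; if $n=2(k+1)$, it consists of the single root $(k+1,j)$ satisfying (ii) and (iii). - $L_S^+$: all roots $\gamma\in R_0\sqcup R_-$ that lie in the same column as, and strictly above, some root of $L_S^0$. - $L_S^-$: a root $(n-i,j)$ belongs to $L_S^-$ if and only if $(i,j)$ belongs to $L_S^+$. $\Lambda_S$ is the set of all functions $a:L_S^0\sqcup L_S^{00}\sqcup L_S^-\to\mathbb{F}_q$ with $a(\gamma)\ne0$ for all $\gamma\in L_S^0$. For $a\in\Lambda_S$ the linear form $\lambda_{S,a}$ on $\mathfrak{g}$ is defined by: $\lambda_{S,a}(E_\gamma)=\lambda(E_\gamma)$ for all $\gamma\in\Pi_0\setminus\Pi$ and all $\gamma\in S$; $\lambda_{S,a}(E_\gamma)=a(\gamma)$ for $\gamma\in L_S^0\sqcup L_S^{00}\sqcup L_S^-$; $\lambda_{S,a}(E_\gamma)=0$ for all other roots $\gamma$. *)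

theory Defs
  imports "Jordan_Normal_Form.VS_Connect" "HOL-Algebra.Group_Action" "HOL-Library.FuncSet"
begin

text \<open>
  The finite field is a type of class \<open>{finite, field}\<close>. Roots \<open>(i, j)\<close> are numbered from \<open>1\<close>,
  as in the literature, while matrix entries \<open>A $$ (r, c)\<close> are numbered from \<open>0\<close>; so the box
  \<open>(i, j)\<close> is the entry \<open>(i - 1, j - 1)\<close>.
\<close>

section \<open>Roots\<close>

definition roots :: "nat \<Rightarrow> (nat \<times> nat) set" where
  "roots n = {(i, j). 1 \<le> i \<and> i < j \<and> j \<le> n}"

definition roots_plus :: "nat \<Rightarrow> (nat \<times> nat) set" where
  "roots_plus n = {(i, j) \<in> roots n. i + j < n + 1}"

definition roots_zero :: "nat \<Rightarrow> (nat \<times> nat) set" where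
  "roots_zero n = {(i, j) \<in> roots n. i + j = n + 1}"

definition roots_minus :: "nat \<Rightarrow> (nat \<times> nat) set" where
  "roots_minus n = {(i, j) \<in> roots n. i + j > n + 1}"

definition half :: "nat \<Rightarrow> nat" where
  "half n = (n - 1) div 2"

definition Pi_zero :: "nat \<Rightarrow> (nat \<times> nat) set" where
  "Pi_zero n = {(i, i + 1) | i. 1 \<le> i \<and> i \<le> half n}"

definition Pi_roots :: "nat \<Rightarrow> (nat \<times> nat) set" where
  "Pi_roots n = {(i, n - i) | i. 1 \<le> i \<and> i \<le> half n}"

section \<open>The algebras, their characters, and the coadjoint action\<close>

definition strict_upper :: "nat \<Rightarrow> 'a::field mat set" where
  "strict_upper n = {x \<in> carrier_mat n n. \<forall>r < n. \<forall>c \<le> r. x $$ (r, c) = 0}"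

definition mat_unit :: "nat \<Rightarrow> nat \<times> nat \<Rightarrow> 'a::field mat" where
  "mat_unit n \<gamma> = mat n n (\<lambda>(r, c). if (r + 1, c + 1) = \<gamma> then 1 else 0)"

abbreviation mat_span :: "nat \<Rightarrow> 'a::field mat set \<Rightarrow> 'a mat set" where
  "mat_span n \<equiv> LinearCombinations.module.span class_ring (module_mat TYPE('a) n n)"

definition g_plus :: "nat \<Rightarrow> 'a::field mat set" where
  "g_plus n = mat_span n (mat_unit n ` roots_plus n)"

text \<open>
  Linear forms on a space \<open>A\<close> of matrices are extensional (\<open>undefined\<close> outside \<open>A\<close>), so that equality
  of functions is equality of linear forms on \<open>A\<close>.
\<close>

definition linear_forms :: "'a::field mat set \<Rightarrow> ('a mat \<Rightarrow> 'a) set" where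
  "linear_forms A = {f \<in> extensional A.
     (\<forall>x\<in>A. \<forall>y\<in>A. f (x + y) = f x + f y) \<and> (\<forall>c. \<forall>x\<in>A. f (c \<cdot>\<^sub>m x) = c * f x)}"

definition square_alg :: "nat \<Rightarrow> 'a::field mat set \<Rightarrow> 'a mat set" where
  "square_alg n A = mat_span n {x * y | x y. x \<in> A \<and> y \<in> A}"

definition characters :: "nat \<Rightarrow> 'a::field mat set \<Rightarrow> ('a mat \<Rightarrow> 'a) set" where
  "characters n A = {f \<in> linear_forms A. \<forall>x \<in> square_alg n A. f x = 0}"

definition nondegenerate :: "nat \<Rightarrow> ('a::field mat \<Rightarrow> 'a) \<Rightarrow> bool" where
  "nondegenerate n lam \<longleftrightarrow> (\<forall>\<gamma> \<in> Pi_roots n - Pi_zero n. lam (mat_unit n \<gamma>) \<noteq> 0)"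

definition UT :: "nat \<Rightarrow> 'a::field mat monoid" where
  "UT n = \<lparr>carrier = {1\<^sub>m n + x | x. x \<in> strict_upper n}, mult = (*), one = 1\<^sub>m n\<rparr>"

definition coad :: "nat \<Rightarrow> 'a::field mat \<Rightarrow> ('a mat \<Rightarrow> 'a) \<Rightarrow> ('a mat \<Rightarrow> 'a)" where
  "coad n g f = (\<lambda>x \<in> strict_upper n. f (inv\<^bsub>UT n\<^esub> g * x * g))"

definition coadjoint_orbits :: "nat \<Rightarrow> ('a::field mat \<Rightarrow> 'a) set set" where
  "coadjoint_orbits n = orbits (UT n) (linear_forms (strict_upper n)) (coad n)"

section \<open>The linear forms attached to subsets of \<open>Pi_roots\<close>\<close>

definition free_box :: "(nat \<times> nat) set \<Rightarrow> nat \<times> nat \<Rightarrow> bool" where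
  "free_box S \<gamma> \<longleftrightarrow> (\<forall>\<delta> \<in> S. fst \<delta> \<noteq> fst \<gamma> \<and> snd \<delta> \<noteq> snd \<gamma>)"

definition corner_filled :: "nat \<Rightarrow> (nat \<times> nat) set \<Rightarrow> nat \<times> nat \<Rightarrow> bool" where
  "corner_filled n S \<gamma> \<longleftrightarrow>
     (\<forall>\<delta> \<in> Pi_roots n. fst \<delta> < fst \<gamma> \<and> snd \<delta> < snd \<gamma> \<longrightarrow> \<delta> \<in> S)"

definition L_zero :: "nat \<Rightarrow> (nat \<times> nat) set \<Rightarrow> (nat \<times> nat) set" where
  "L_zero n S = {(i, j) \<in> roots n. 1 \<le> i \<and> i \<le> half n \<and> i + j \<ge> n + 1 \<and>
     free_box S (i, j) \<and> corner_filled n S (i, j)}"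

text \<open>
  For even \<open>n = 2 * (half n + 1)\<close> and \<open>S \<subseteq> Pi_roots n\<close> the next set is a singleton: its only column
  is the leftmost column \<open>j > half n + 1\<close> that contains no root of \<open>S\<close>.
\<close>

definition L_zerozero :: "nat \<Rightarrow> (nat \<times> nat) set \<Rightarrow> (nat \<times> nat) set" where
  "L_zerozero n S = (if odd n then {} else
     {(i, j) \<in> roots n. i = half n + 1 \<and> free_box S (i, j) \<and> corner_filled n S (i, j)})"

definition L_plus :: "nat \<Rightarrow> (nat \<times> nat) set \<Rightarrow> (nat \<times> nat) set" where
  "L_plus n S = {(i, j) \<in> roots_zero n \<union> roots_minus n. \<exists>i'. (i', j) \<in> L_zero n S \<and> i < i'}"

definition L_minus :: "nat \<Rightarrow> (nat \<times> nat) set \<Rightarrow> (nat \<times> nat) set" where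
  "L_minus n S = {(n - i, j) | i j. (i, j) \<in> L_plus n S}"

definition Lambda_set :: "nat \<Rightarrow> (nat \<times> nat) set \<Rightarrow> (nat \<times> nat \<Rightarrow> 'a::field) set" where
  "Lambda_set n S = {a \<in> (L_zero n S \<union> L_zerozero n S \<union> L_minus n S) \<rightarrow>\<^sub>E UNIV.
     \<forall>\<gamma> \<in> L_zero n S. a \<gamma> \<noteq> 0}"

definition lambda_coeff ::
  "nat \<Rightarrow> ('a::field mat \<Rightarrow> 'a) \<Rightarrow> (nat \<times> nat) set \<Rightarrow> (nat \<times> nat \<Rightarrow> 'a) \<Rightarrow> nat \<times> nat \<Rightarrow> 'a" where
  "lambda_coeff n lam S a \<gamma> =
     (if \<gamma> \<in> (Pi_zero n - Pi_roots n) \<union> S then lam (mat_unit n \<gamma>)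
      else if \<gamma> \<in> L_zero n S \<union> L_zerozero n S \<union> L_minus n S then a \<gamma>
      else 0)"

text \<open>The linear form on the strictly upper triangular matrices with value \<open>lambda_coeff n lam S a \<gamma>\<close>
  on each matrix unit \<open>mat_unit n \<gamma>\<close>.\<close>

definition lambda_form ::
  "nat \<Rightarrow> ('a::field mat \<Rightarrow> 'a) \<Rightarrow> (nat \<times> nat) set \<Rightarrow> (nat \<times> nat \<Rightarrow> 'a) \<Rightarrow> 'a mat \<Rightarrow> 'a" where
  "lambda_form n lam S a = (\<lambda>x \<in> strict_upper n.
     \<Sum>(i, j) \<in> roots n. lambda_coeff n lam S a (i, j) * x $$ (i - 1, j - 1))"

lemma finite_roots: "finite (roots n)"
  by (rule finite_subset[of _ "{..n} \<times> {..n}"]) (auto simp: roots_def)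

lemma mat_unit_strict_upper:
  assumes "\<gamma> \<in> roots n"
  shows "mat_unit n \<gamma> \<in> strict_upper n"
  using assms by (auto simp: mat_unit_def strict_upper_def roots_def)

lemma lambda_form_mat_unit:
  assumes "\<gamma> \<in> roots n"
  shows "lambda_form n lam S a (mat_unit n \<gamma>) = lambda_coeff n lam S a \<gamma>"
proof -
  have "lambda_form n lam S a (mat_unit n \<gamma>) =
      (\<Sum>\<delta> \<in> roots n. if \<delta> = \<gamma> then lambda_coeff n lam S a \<delta> else 0)"
    unfolding lambda_form_def using mat_unit_strict_upper[OF assms]
    by (auto intro!: sum.cong simp: mat_unit_def roots_def)
  then show ?thesis
    using assms finite_roots by simp
qed

end

theory Submission
  imports Defs "Jordan_Normal_Form.Determinant"
begin

text \<open>
  View a linear form as the array \<open>F\<close> of its values on matrix units. Two forms lie in a common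
  orbit only if some unitriangular \<open>h\<close> satisfies
  \<open>F' (i, j) + \<Sum>\<^sub>l\<^sub><\<^sub>i h i l F' (l, j) = F (i, j) + \<Sum>\<^sub>l\<^sub>>\<^sub>j F (i, l) h l j\<close> for all roots \<open>(i, j)\<close>.
  The boxes of the forms in question in the rows \<open>\<le> n - 1 - k\<close> and columns \<open>\<ge> n - k\<close> form a monomial
  matrix, which is determined by these equations just as in the Bruhat decomposition. Hence the forms
  agree there, and \<open>S = S'\<close>. For a box \<open>(n - i, j)\<close> of \<open>L\<^sub>S\<^sup>-\<close>, the form does not vanish on
  \<open>(i, n - i) \<in> S\<close>, so the equations in row \<open>i\<close> force \<open>h (n - i) q = 0\<close> for every row \<open>q < n - i\<close> that meets
  the support in column \<open>j\<close>; the equation at \<open>(n - i, j)\<close> then says that the two forms agree there.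
\<close>

section \<open>The unitriangular group\<close>

lemma UT_carrier_iff:
  "g \<in> carrier (UT n) \<longleftrightarrow>
     g \<in> carrier_mat n n \<and> (\<forall>r<n. g $$ (r, r) = 1 \<and> (\<forall>c<r. g $$ (r, c) = 0))"
proof
  assume "g \<in> carrier (UT n)"
  then show "g \<in> carrier_mat n n \<and> (\<forall>r<n. g $$ (r, r) = 1 \<and> (\<forall>c<r. g $$ (r, c) = 0))"
    by (auto simp: UT_def strict_upper_def)
next
  assume g: "g \<in> carrier_mat n n \<and> (\<forall>r<n. g $$ (r, r) = 1 \<and> (\<forall>c<r. g $$ (r, c) = 0))"
  then have "g - 1\<^sub>m n \<in> strict_upper n"
    by (auto simp: strict_upper_def le_less)
  moreover have "g = 1\<^sub>m n + (g - 1\<^sub>m n)"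
    using g by (intro eq_matI) auto
  ultimately show "g \<in> carrier (UT n)"
    by (auto simp: UT_def)
qed

lemma mat_mult_index:
  assumes "A \<in> carrier_mat n n" "B \<in> carrier_mat n n" "r < n" "c < n"
  shows "(A * B) $$ (r, c) = (\<Sum>l<n. A $$ (r, l) * B $$ (l, c))"
  using assms by (auto simp: scalar_prod_def lessThan_atLeast0 intro!: sum.cong)

text \<open>In each summand either \<open>l < r\<close>, where \<open>g\<close> vanishes, or
  \<open>c <= r <= l\<close>, where \<open>x\<close> vanishes. The one-sided versions keep
  \<open>u * y\<close> and \<open>y * u\<close> in the domain of the forms once the orbit relation
  is written without inverses.\<close>

lemma UT_mult_strict_upper:
  assumes "g \<in> carrier (UT n)" "x \<in> strict_upper n"
  shows "g * x \<in> strict_upper n"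
proof -
  have g: "g \<in> carrier_mat n n" and x: "x \<in> carrier_mat n n"
    using assms by (auto simp: UT_carrier_iff strict_upper_def)
  have "(g * x) $$ (r, c) = 0" if "r < n" "c \<le> r" for r c
  proof -
    have "g $$ (r, l) * x $$ (l, c) = 0" if "l < n" for l
      using assms that \<open>r < n\<close> \<open>c \<le> r\<close>
      by (cases "l < r") (auto simp: UT_carrier_iff strict_upper_def)
    then show ?thesis
      using that by (subst mat_mult_index[OF g x]) (auto intro!: sum.neutral)
  qed
  then show ?thesis
    using g x by (auto simp: strict_upper_def)
qed

lemma strict_upper_mult_UT:
  assumes "x \<in> strict_upper n" "g \<in> carrier (UT n)"
  shows "x * g \<in> strict_upper n"
proof -
  have g: "g \<in> carrier_mat n n" and x: "x \<in> carrier_mat n n"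
    using assms by (auto simp: UT_carrier_iff strict_upper_def)
  have "(x * g) $$ (r, c) = 0" if "r < n" "c \<le> r" for r c
  proof -
    have "x $$ (r, l) * g $$ (l, c) = 0" if "l < n" for l
      using assms that \<open>r < n\<close> \<open>c \<le> r\<close>
      by (cases "l \<le> r") (auto simp: UT_carrier_iff strict_upper_def)
    then show ?thesis
      using that by (subst mat_mult_index[OF x g]) (auto intro!: sum.neutral)
  qed
  then show ?thesis
    using g x by (auto simp: strict_upper_def)
qed

text \<open>Determinant 1 gives an inverse; comparing the entries of \<open>g * h = 1\<close> from
  the last row upwards shows that it is again unitriangular.\<close>

lemma UT_left_inverse_exists:
  fixes g :: "'a::field mat"
  assumes "g \<in> carrier (UT n)"
  shows "\<exists>h \<in> carrier (UT n). h * g = 1\<^sub>m n"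
proof -
  have g: "g \<in> carrier_mat n n" and g1: "\<And>r. r < n \<Longrightarrow> g $$ (r, r) = 1"
    and g0: "\<And>r c. r < n \<Longrightarrow> c < r \<Longrightarrow> g $$ (r, c) = 0"
    using assms by (auto simp: UT_carrier_iff)
  have "det g = 1"
    using g g1 g0 by (subst det_upper_triangular[of _ n]) (auto simp: prod_list_diag_prod)
  then obtain h where h: "h \<in> carrier_mat n n" "h * g = 1\<^sub>m n" "g * h = 1\<^sub>m n"
    using det_non_zero_imp_unit[OF g, of undefined]
    by (auto simp: Units_def ring_mat_def)
  have hval: "h $$ (r, c) = (if r = c then 1 else 0)" if "r < n" "c \<le> r" for r c
    using that
  proof (induction "n - r" arbitrary: r rule: less_induct)
    case less
    have "(g * h) $$ (r, c) = (\<Sum>l<n. g $$ (r, l) * h $$ (l, c))"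
      using g h less.prems by (intro mat_mult_index) auto
    \<comment> \<open>Only \<open>l = r\<close> survives: \<open>g\<close> vanishes left of its
      diagonal, and for \<open>l > r\<close> the induction hypothesis gives
      \<open>h $$ (l, c) = 0\<close>, as \<open>c <= r < l\<close>.\<close>
    also have "\<dots> = (\<Sum>l\<in>{r}. g $$ (r, l) * h $$ (l, c))"
    proof (rule sum.mono_neutral_right)
      show "\<forall>l\<in>{..<n} - {r}. g $$ (r, l) * h $$ (l, c) = 0"
      proof
        fix l assume l: "l \<in> {..<n} - {r}"
        show "g $$ (r, l) * h $$ (l, c) = 0"
        proof (cases "l < r")
          case True
          then show ?thesis using g0 less.prems by simp
        next
          case False
          then have "h $$ (l, c) = (if l = c then 1 else 0)"
            using l less.prems by (intro less.hyps) auto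
          moreover have "l \<noteq> c" using False l less.prems by auto
          ultimately show ?thesis by simp
        qed
      qed
    qed (use less.prems in auto)
    finally show ?case
      using h(3) g1 less.prems by simp
  qed
  then have "h \<in> carrier (UT n)"
    using h by (auto simp: UT_carrier_iff)
  with h show ?thesis by blast
qed

lemma UT_mult_closed:
  assumes "g \<in> carrier (UT n)" "h \<in> carrier (UT n)"
  shows "g * h \<in> carrier (UT n)"
proof -
  obtain x where x: "x \<in> strict_upper n" "h = 1\<^sub>m n + x"
    using assms(2) by (auto simp: UT_def)
  have g: "g \<in> carrier_mat n n" and xc: "x \<in> carrier_mat n n"
    using assms x by (auto simp: UT_carrier_iff strict_upper_def)
  have gx: "g * x \<in> strict_upper n"
    using assms(1) x(1) by (rule UT_mult_strict_upper)
  have "g * h = g + g * x"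
    using g xc x(2) by (simp add: mult_add_distrib_mat[OF g one_carrier_mat xc])
  then show ?thesis
    using assms(1) gx by (auto simp: UT_carrier_iff strict_upper_def)
qed

lemma group_UT: "group (UT n :: 'a::field mat monoid)"
proof (rule groupI)
  fix x y z :: "'a mat"
  assume "x \<in> carrier (UT n)"
  then have x: "x \<in> carrier_mat n n" by (simp add: UT_carrier_iff)
  show "\<one>\<^bsub>UT n\<^esub> \<otimes>\<^bsub>UT n\<^esub> x = x"
    using x by (simp add: UT_def)
  assume "y \<in> carrier (UT n)" "z \<in> carrier (UT n)"
  then have "y \<in> carrier_mat n n" "z \<in> carrier_mat n n" by (simp_all add: UT_carrier_iff)
  with x show "x \<otimes>\<^bsub>UT n\<^esub> y \<otimes>\<^bsub>UT n\<^esub> z = x \<otimes>\<^bsub>UT n\<^esub> (y \<otimes>\<^bsub>UT n\<^esub> z)"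
    by (simp add: UT_def)
next
  fix x y :: "'a mat"
  assume "x \<in> carrier (UT n)" "y \<in> carrier (UT n)"
  then show "x \<otimes>\<^bsub>UT n\<^esub> y \<in> carrier (UT n)"
    using UT_mult_closed[of x n y] by (simp add: UT_def)
next
  show "\<one>\<^bsub>UT n\<^esub> \<in> carrier (UT n :: 'a mat monoid)"
    unfolding UT_carrier_iff by (simp add: UT_def)
next
  fix x :: "'a mat"
  assume "x \<in> carrier (UT n)"
  then show "\<exists>y \<in> carrier (UT n). y \<otimes>\<^bsub>UT n\<^esub> x = \<one>\<^bsub>UT n\<^esub>"
    using UT_left_inverse_exists[of x n] by (simp add: UT_def)
qed

section \<open>Linear forms in coordinates\<close>

text \<open>An arbitrary array replaces \<open>lambda_coeff\<close>, so that the orbit equations are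
  derived before the combinatorics of the boxes enters.\<close>

definition root_form :: "nat \<Rightarrow> (nat \<times> nat \<Rightarrow> 'a::field) \<Rightarrow> 'a mat \<Rightarrow> 'a" where
  "root_form n F = (\<lambda>x \<in> strict_upper n. \<Sum>(i, j) \<in> roots n. F (i, j) * x $$ (i - 1, j - 1))"

lemma lambda_form_eq_root_form: "lambda_form n lam S a = root_form n (lambda_coeff n lam S a)"
  by (simp add: lambda_form_def root_form_def)

lemma root_form_cong:
  assumes "\<And>i j. (i, j) \<in> roots n \<Longrightarrow> F (i, j) = F' (i, j)"
  shows "root_form n F = root_form n F'"
  unfolding root_form_def using assms by (intro restrict_ext sum.cong) auto

lemma root_form_linear: "root_form n F \<in> linear_forms (strict_upper n)"
proof -
  have "(\<Sum>(i, j) \<in> roots n. F (i, j) * (x + y) $$ (i - 1, j - 1)) =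
        (\<Sum>(i, j) \<in> roots n. F (i, j) * x $$ (i - 1, j - 1)) + (\<Sum>(i, j) \<in> roots n. F (i, j) * y $$ (i - 1, j - 1))"
    if "x \<in> strict_upper n" "y \<in> strict_upper n" for x y
    using that unfolding sum.distrib[symmetric]
    by (intro sum.cong) (auto simp: strict_upper_def roots_def ring_distribs)
  moreover have "(\<Sum>(i, j) \<in> roots n. F (i, j) * (c \<cdot>\<^sub>m x) $$ (i - 1, j - 1)) =
        c * (\<Sum>(i, j) \<in> roots n. F (i, j) * x $$ (i - 1, j - 1))"
    if "x \<in> strict_upper n" for x c
    using that unfolding sum_distrib_left
    by (intro sum.cong) (auto simp: strict_upper_def roots_def)
  moreover have "x + y \<in> strict_upper n" "c \<cdot>\<^sub>m x \<in> strict_upper n"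
    if "x \<in> strict_upper n" "y \<in> strict_upper n" for x y :: "'a mat" and c
    using that by (auto simp: strict_upper_def)
  ultimately show ?thesis
    by (auto simp: linear_forms_def root_form_def)
qed

lemma mat_unit_index:
  assumes "(i, j) \<in> roots n" "r < n" "c < n"
  shows "mat_unit n (i, j) $$ (r, c) = (if r = i - 1 \<and> c = j - 1 then 1 else 0)"
  using assms by (auto simp: mat_unit_def roots_def)

text \<open>The product is column \<open>i\<close> of \<open>g\<close> moved to column
  \<open>j\<close>; as \<open>g\<close> is upper triangular, the sum stops at row
  \<open>i\<close>.\<close>

lemma root_form_mult_mat_unit:
  assumes "g \<in> carrier (UT n)" "(i, j) \<in> roots n"
  shows "root_form n F (g * mat_unit n (i, j)) = (\<Sum>l\<in>{1..i}. F (l, j) * g $$ (l - 1, i - 1))"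
proof -
  have g: "g \<in> carrier_mat n n"
    using assms by (auto simp: UT_carrier_iff)
  have idx: "(g * mat_unit n (i, j)) $$ (r - 1, c - 1) = (if c = j then g $$ (r - 1, i - 1) else 0)"
    if "(r, c) \<in> roots n" for r c
  proof -
    have "(g * mat_unit n (i, j)) $$ (r - 1, c - 1) =
        (\<Sum>l<n. g $$ (r - 1, l) * mat_unit n (i, j) $$ (l, c - 1))"
      using that g by (intro mat_mult_index) (auto simp: roots_def mat_unit_def)
    also have "\<dots> = (\<Sum>l<n. if l = i - 1 then (if c = j then g $$ (r - 1, i - 1) else 0) else 0)"
    proof (rule sum.cong)
      fix l assume "l \<in> {..<n}"
      moreover have "c - 1 < n" "c - 1 = j - 1 \<longleftrightarrow> c = j"
        using that assms(2) by (auto simp: roots_def)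
      ultimately show "g $$ (r - 1, l) * mat_unit n (i, j) $$ (l, c - 1) =
          (if l = i - 1 then (if c = j then g $$ (r - 1, i - 1) else 0) else 0)"
        by (simp add: mat_unit_index[OF assms(2)])
    qed simp
    finally show ?thesis
      using assms(2) by (auto simp: roots_def)
  qed
  have "g * mat_unit n (i, j) \<in> strict_upper n"
    using assms mat_unit_strict_upper UT_mult_strict_upper by blast
  then have "root_form n F (g * mat_unit n (i, j)) =
      (\<Sum>(r, c) \<in> roots n. if c = j then F (r, c) * g $$ (r - 1, i - 1) else 0)"
    unfolding root_form_def by (auto simp: idx simp del: One_nat_def intro!: sum.cong)
  also have "\<dots> = (\<Sum>(r, c) \<in> (\<lambda>l. (l, j)) ` {1..i}. F (r, c) * g $$ (r - 1, i - 1))"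
    using assms finite_roots
    by (intro sum.mono_neutral_cong_right) (auto simp: roots_def UT_carrier_iff image_iff)
  also have "\<dots> = (\<Sum>l\<in>{1..i}. F (l, j) * g $$ (l - 1, i - 1))"
    by (subst sum.reindex) (auto simp: inj_on_def)
  finally show ?thesis .
qed

text \<open>The mirror image: row \<open>j\<close> of \<open>g\<close> is moved to row
  \<open>i\<close>, and its nonzero entries start at column \<open>j\<close>.\<close>

lemma root_form_mat_unit_mult:
  assumes "g \<in> carrier (UT n)" "(i, j) \<in> roots n"
  shows "root_form n F (mat_unit n (i, j) * g) = (\<Sum>l\<in>{j..n}. F (i, l) * g $$ (j - 1, l - 1))"
proof -
  have g: "g \<in> carrier_mat n n"
    using assms by (auto simp: UT_carrier_iff)
  have idx: "(mat_unit n (i, j) * g) $$ (r - 1, c - 1) = (if r = i then g $$ (j - 1, c - 1) else 0)"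
    if "(r, c) \<in> roots n" for r c
  proof -
    have "(mat_unit n (i, j) * g) $$ (r - 1, c - 1) =
        (\<Sum>l<n. mat_unit n (i, j) $$ (r - 1, l) * g $$ (l, c - 1))"
      using that g by (intro mat_mult_index) (auto simp: roots_def mat_unit_def)
    also have "\<dots> = (\<Sum>l<n. if l = j - 1 then (if r = i then g $$ (j - 1, c - 1) else 0) else 0)"
    proof (rule sum.cong)
      fix l assume "l \<in> {..<n}"
      moreover have "r - 1 < n" "r - 1 = i - 1 \<longleftrightarrow> r = i"
        using that assms(2) by (auto simp: roots_def)
      ultimately show "mat_unit n (i, j) $$ (r - 1, l) * g $$ (l, c - 1) =
          (if l = j - 1 then (if r = i then g $$ (j - 1, c - 1) else 0) else 0)"
        by (simp add: mat_unit_index[OF assms(2)])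
    qed simp
    finally show ?thesis
      using assms(2) by (auto simp: roots_def)
  qed
  have "mat_unit n (i, j) * g \<in> strict_upper n"
    using assms mat_unit_strict_upper strict_upper_mult_UT by blast
  then have "root_form n F (mat_unit n (i, j) * g) =
      (\<Sum>(r, c) \<in> roots n. if r = i then F (r, c) * g $$ (j - 1, c - 1) else 0)"
    unfolding root_form_def by (auto simp: idx simp del: One_nat_def intro!: sum.cong)
  also have "\<dots> = (\<Sum>(r, c) \<in> Pair i ` {j..n}. F (r, c) * g $$ (j - 1, c - 1))"
    using assms finite_roots
    by (intro sum.mono_neutral_cong_right) (auto simp: roots_def UT_carrier_iff image_iff)
  also have "\<dots> = (\<Sum>l\<in>{j..n}. F (i, l) * g $$ (j - 1, l - 1))"
    by (subst sum.reindex) (auto simp: inj_on_def)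
  finally show ?thesis .
qed

section \<open>Coadjoint orbits expressed by equations between coefficient arrays\<close>

lemma coad_self_orbit:
  assumes "f \<in> linear_forms (strict_upper n)"
  shows "\<exists>\<Omega> \<in> coadjoint_orbits n. f \<in> \<Omega>"
proof -
  have one: "\<one>\<^bsub>UT n\<^esub> = 1\<^sub>m n" by (simp add: UT_def)
  \<comment> \<open>Outside \<open>strict_upper n\<close> both sides are \<open>undefined\<close>,
    since \<open>f\<close> is extensional.\<close>
  have "coad n \<one>\<^bsub>UT n\<^esub> f x = f x" for x
    unfolding coad_def monoid.inv_one[OF group.is_monoid[OF group_UT]] using assms
    by (cases "x \<in> strict_upper n") (auto simp: one strict_upper_def linear_forms_def extensional_def)
  then have "coad n \<one>\<^bsub>UT n\<^esub> f = f" by blast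
  moreover have "\<one>\<^bsub>UT n\<^esub> \<in> carrier (UT n :: 'a mat monoid)"
    by (intro monoid.one_closed group.is_monoid group_UT)
  ultimately have "f \<in> orbit (UT n) (coad n) f"
    unfolding orbit_def by (auto intro: exI[of _ "\<one>\<^bsub>UT n\<^esub>"])
  then show ?thesis
    unfolding coadjoint_orbits_def orbits_def using assms by blast
qed

text \<open>The relation \<open>f' x = f (inv u * x * u)\<close> is taken at
  \<open>x = u * y\<close>. This removes the inverse and, for linear forms, leaves a condition
  linear in the entries of \<open>u\<close>.\<close>

lemma coad_common_orbit:
  assumes "\<Omega> \<in> coadjoint_orbits n" "f \<in> \<Omega>" "f' \<in> \<Omega>"
  obtains u where "u \<in> carrier (UT n)" "\<And>y. y \<in> strict_upper n \<Longrightarrow> f' (u * y) = f (y * u)"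
proof -
  obtain f0 g g' where g: "g \<in> carrier (UT n)" "f = coad n g f0"
    and g': "g' \<in> carrier (UT n)" "f' = coad n g' f0"
    using assms by (auto simp: coadjoint_orbits_def orbits_def orbit_def)
  interpret U: group "UT n :: 'a mat monoid" by (rule group_UT)
  \<comment> \<open>With this \<open>u\<close>, both \<open>f' (u * y)\<close> and
    \<open>f (y * u)\<close> unfold to \<open>f0 (inv g * y * g')\<close>.\<close>
  define u where "u = g' * inv\<^bsub>UT n\<^esub> g"
  have mult: "x \<otimes>\<^bsub>UT n\<^esub> y = x * y" and one: "\<one>\<^bsub>UT n\<^esub> = 1\<^sub>m n" for x y :: "'a mat"
    by (simp_all add: UT_def)
  have u: "u \<in> carrier (UT n)"
    unfolding u_def using g g' U.m_closed[of g' "inv\<^bsub>UT n\<^esub> g"] by (simp add: mult)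
  have c: "g \<in> carrier_mat n n" "g' \<in> carrier_mat n n"
      "inv\<^bsub>UT n\<^esub> g \<in> carrier_mat n n" "inv\<^bsub>UT n\<^esub> g' \<in> carrier_mat n n"
    using g g' U.inv_closed[of g] U.inv_closed[of g'] by (auto simp: UT_carrier_iff)
  have inv: "inv\<^bsub>UT n\<^esub> g * g = 1\<^sub>m n" "inv\<^bsub>UT n\<^esub> g' * g' = 1\<^sub>m n"
    using U.l_inv[of g] U.l_inv[of g'] g g' by (simp_all add: mult one)
  have "f' (u * y) = f (y * u)" if y: "y \<in> strict_upper n" for y
  proof -
    have yc: "y \<in> carrier_mat n n" using y by (simp add: strict_upper_def)
    have "inv\<^bsub>UT n\<^esub> g' * (u * y) * g' = (inv\<^bsub>UT n\<^esub> g' * g') * (inv\<^bsub>UT n\<^esub> g * y * g')"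
      unfolding u_def using c yc by (simp add: assoc_mult_mat[of _ n n _ n _ n])
    also have "\<dots> = inv\<^bsub>UT n\<^esub> g * y * g'"
      using c yc inv by simp
    finally have 1: "inv\<^bsub>UT n\<^esub> g' * (u * y) * g' = inv\<^bsub>UT n\<^esub> g * y * g'" .
    have "inv\<^bsub>UT n\<^esub> g * (y * u) * g = (inv\<^bsub>UT n\<^esub> g * y * g') * (inv\<^bsub>UT n\<^esub> g * g)"
      unfolding u_def using c yc by (simp add: assoc_mult_mat[of _ n n _ n _ n])
    also have "\<dots> = inv\<^bsub>UT n\<^esub> g * y * g'"
      using c yc inv by (simp add: right_mult_one_mat[of _ n n])
    finally have 2: "inv\<^bsub>UT n\<^esub> g * (y * u) * g = inv\<^bsub>UT n\<^esub> g * y * g'" .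
    show ?thesis
      using UT_mult_strict_upper[OF u y] strict_upper_mult_UT[OF y u]
      by (simp add: g g' coad_def 1 2)
  qed
  with u show thesis by (rule that)
qed

text \<open>Each matrix unit, taken for \<open>y\<close>, gives one equation. Here \<open>h\<close>
  is the transpose of \<open>u\<close> with indices counted from 1; the diagonal entries 1 of
  \<open>u\<close> account for the two terms outside the sums.\<close>

lemma root_forms_common_orbit:
  assumes "\<Omega> \<in> coadjoint_orbits n" "root_form n F \<in> \<Omega>" "root_form n F' \<in> \<Omega>"
  obtains h where "\<And>i j. (i, j) \<in> roots n \<Longrightarrow>
    F' (i, j) + (\<Sum>l\<in>{1..<i}. h i l * F' (l, j)) = F (i, j) + (\<Sum>l\<in>{j<..n}. F (i, l) * h l j)"
proof -
  obtain u where u: "u \<in> carrier (UT n)"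
    and uy: "\<And>y. y \<in> strict_upper n \<Longrightarrow> root_form n F' (u * y) = root_form n F (y * u)"
    using coad_common_orbit[OF assms] by blast
  have "F' (i, j) + (\<Sum>l\<in>{1..<i}. u $$ (l - 1, i - 1) * F' (l, j)) =
      F (i, j) + (\<Sum>l\<in>{j<..n}. F (i, l) * u $$ (j - 1, l - 1))" if ij: "(i, j) \<in> roots n" for i j
  proof -
    have le: "1 \<le> i" "i < j" "j \<le> n" using ij by (auto simp: roots_def)
    then have d: "u $$ (i - 1, i - 1) = 1" "u $$ (j - 1, j - 1) = 1"
      using u by (auto simp: UT_carrier_iff)
    have "{1..i} = insert i {1..<i}" "{j..n} = insert j {j<..n}" using le by auto
    then show ?thesis
      using uy[OF mat_unit_strict_upper[OF ij]] d
      by (simp add: root_form_mult_mat_unit[OF u ij] root_form_mat_unit_mult[OF u ij] mult.commute)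
  qed
  then show thesis by (rule that)
qed

section \<open>Uniqueness of monomial corners\<close>

text \<open>The block is closed under moving up and right, so both sums stay inside it. Going down
  the rows, both sums vanish in the equation at a nonzero box of \<open>F\<close>, which carries the
  entry over to \<open>F'\<close>.\<close>

lemma monomial_corner_unique:
  fixes F F' :: "nat \<times> nat \<Rightarrow> 'a::field"
  assumes eq: "\<And>i j. 1 \<le> i \<Longrightarrow> i \<le> p \<Longrightarrow> q \<le> j \<Longrightarrow> j \<le> n \<Longrightarrow>
      F' (i, j) + (\<Sum>l\<in>{1..<i}. h i l * F' (l, j)) = F (i, j) + (\<Sum>l\<in>{j<..n}. F (i, l) * h l j)"
    and row: "\<And>i j j'. 1 \<le> i \<Longrightarrow> i \<le> p \<Longrightarrow> q \<le> j \<Longrightarrow> q \<le> j' \<Longrightarrow> j \<le> n \<Longrightarrow> j' \<le> n \<Longrightarrow>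
      F (i, j) \<noteq> 0 \<Longrightarrow> F (i, j') \<noteq> 0 \<Longrightarrow> j = j'"
    and col: "\<And>i i' j. 1 \<le> i \<Longrightarrow> i \<le> p \<Longrightarrow> 1 \<le> i' \<Longrightarrow> i' \<le> p \<Longrightarrow> q \<le> j \<Longrightarrow> j \<le> n \<Longrightarrow>
      F (i, j) \<noteq> 0 \<Longrightarrow> F (i', j) \<noteq> 0 \<Longrightarrow> i = i'"
    and row': "\<And>i j j'. 1 \<le> i \<Longrightarrow> i \<le> p \<Longrightarrow> q \<le> j \<Longrightarrow> q \<le> j' \<Longrightarrow> j \<le> n \<Longrightarrow> j' \<le> n \<Longrightarrow>
      F' (i, j) \<noteq> 0 \<Longrightarrow> F' (i, j') \<noteq> 0 \<Longrightarrow> j = j'"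
    and col': "\<And>i i' j. 1 \<le> i \<Longrightarrow> i \<le> p \<Longrightarrow> 1 \<le> i' \<Longrightarrow> i' \<le> p \<Longrightarrow> q \<le> j \<Longrightarrow> j \<le> n \<Longrightarrow>
      F' (i, j) \<noteq> 0 \<Longrightarrow> F' (i', j) \<noteq> 0 \<Longrightarrow> i = i'"
    and i: "1 \<le> i" "i \<le> p" and j: "q \<le> j" "j \<le> n"
  shows "F' (i, j) = F (i, j)"
  using i j
proof (induction i arbitrary: j rule: less_induct)
  case (less i)
  show ?case
  proof (cases "\<exists>m. q \<le> m \<and> m \<le> n \<and> F (i, m) \<noteq> 0")
    case True
    then obtain m where m: "q \<le> m" "m \<le> n" "F (i, m) \<noteq> 0" by blast
    \<comment> \<open>Above row \<open>i\<close>, \<open>F'\<close> agrees with \<open>F\<close> by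
      induction, and \<open>F\<close> has its only entry of column \<open>m\<close> in row
      \<open>i\<close>.\<close>
    have "F' (l, m) = 0" if "l \<in> {1..<i}" for l
      using less.IH[of l m] col[of l i m] that m less.prems by force
    moreover have "F (i, l) = 0" if "l \<in> {m<..n}" for l
      using row[of i l m] that m less.prems by force
    ultimately have "F' (i, m) = F (i, m)"
      using eq[of i m] m less.prems by simp
    with m show ?thesis
      using row[of i m j] row'[of i m j] less.prems by metis
  next
    case False
    then have F0: "F (i, m) = 0" if "q \<le> m" "m \<le> n" for m using that by blast
    \<comment> \<open>A nonzero entry of \<open>F'\<close> would be alone in its column, so the left
      sum vanishes; the right side vanishes because row \<open>i\<close> of \<open>F\<close> is zero
      in the block.\<close>
    have "F' (i, j) = 0"
    proof (rule ccontr)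
      assume nz: "F' (i, j) \<noteq> 0"
      then have "F' (l, j) = 0" if "l \<in> {1..<i}" for l
        using col'[of l i j] that less.prems by force
      then show False
        using eq[of i j] nz F0 less.prems by simp
    qed
    with F0 show ?thesis using less.prems by simp
  qed
qed

section \<open>The support of the forms\<close>

lemma L_zero_D:
  assumes "(i, j) \<in> L_zero n S"
  shows "1 \<le> i" "i \<le> half n" "j \<le> n" "n + 1 \<le> i + j" "i < j" "(i, m) \<notin> S" "(m, j) \<notin> S"
    "1 \<le> l \<Longrightarrow> l \<le> half n \<Longrightarrow> l < i \<Longrightarrow> n - l < j \<Longrightarrow> (l, n - l) \<in> S"
  using assms by (auto simp: L_zero_def roots_def free_box_def corner_filled_def Pi_roots_def)

lemma L_zerozero_D:
  assumes "(i, j) \<in> L_zerozero n S"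
  shows "even n" "i = half n + 1" "j \<le> n" "i < j" "(i, m) \<notin> S" "(m, j) \<notin> S"
    "1 \<le> l \<Longrightarrow> l \<le> half n \<Longrightarrow> l < i \<Longrightarrow> n - l < j \<Longrightarrow> (l, n - l) \<in> S"
  using assms by (auto simp: L_zerozero_def roots_def free_box_def corner_filled_def Pi_roots_def split: if_splits)

lemma half_cases: "n > 2 \<Longrightarrow> n = 2 * half n + 1 \<and> odd n \<or> n = 2 * half n + 2 \<and> even n"
  unfolding half_def by presburger

text \<open>The root \<open>(i, n - i)\<close> lies strictly above and, because
  \<open>n + 1 <= i + j\<close>, strictly to the left of \<open>(i0, j)\<close>, so the corner
  condition puts it in \<open>S\<close>. Thus \<open>r\<close> is also the index of a column meeting
  \<open>S\<close>.\<close>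

lemma L_minus_E:
  assumes "(r, j) \<in> L_minus n S" "S \<subseteq> Pi_roots n"
  obtains i i0 where "r = n - i" "1 \<le> i" "i < i0" "(i0, j) \<in> L_zero n S" "n + 1 \<le> i + j" "(i, n - i) \<in> S"
proof -
  obtain i i0 where i: "r = n - i" "1 \<le> i" "i < i0" "(i0, j) \<in> L_zero n S" "n + 1 \<le> i + j"
    using assms by (force simp: L_minus_def L_plus_def roots_zero_def roots_minus_def roots_def)
  moreover have "n - i < j"
    using L_zero_D(5)[OF i(4)] i by linarith
  then have "(i, n - i) \<in> S"
    using L_zero_D(2)[OF i(4)] L_zero_D(8)[OF i(4), of i] i by simp
  ultimately show thesis by (rule that)
qed

text \<open>The box is \<open>(i, n - m)\<close> for the largest \<open>m < i\<close> with
  \<open>(m, n - m)\<close> not in \<open>S\<close>: column \<open>n - m\<close> is then free, and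
  maximality of \<open>m\<close> is the corner condition.\<close>

lemma L_zero_exists:
  assumes "1 \<le> i" "i \<le> half n" "(i, n - i) \<notin> S" "S \<subseteq> Pi_roots n"
  obtains j where "(i, j) \<in> L_zero n S"
proof -
  \<comment> \<open>The value 0 always belongs to \<open>M\<close>, since rows of
    \<open>Pi_roots n\<close> start at 1; it yields the last column \<open>n\<close>.\<close>
  define M where "M = {m. m < i \<and> (m, n - m) \<notin> S}"
  define m where "m = Max M"
  have "finite M" "0 \<in> M" using assms by (auto simp: M_def Pi_roots_def)
  then have "m \<in> M" and max: "\<And>l. l \<in> M \<Longrightarrow> l \<le> m"
    unfolding m_def using Max_in[of M] Max_ge[of M] by blast+
  then have m: "m < i" "(m, n - m) \<notin> S"
    by (auto simp: M_def)
  have lt: "2 * i < n" using assms(1,2) unfolding half_def by presburger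
  have "free_box S (i, n - m)"
    unfolding free_box_def
  proof
    fix \<delta> assume "\<delta> \<in> S"
    then obtain l where l: "\<delta> = (l, n - l)" "1 \<le> l" "l \<le> half n" "(l, n - l) \<in> S"
      using assms by (auto simp: Pi_roots_def)
    have "2 * l < n" using l(2,3) unfolding half_def by presburger
    then have "n - l = n - m \<Longrightarrow> l = m" using m lt by linarith
    with l m assms(3) show "fst \<delta> \<noteq> fst (i, n - m) \<and> snd \<delta> \<noteq> snd (i, n - m)" by auto
  qed
  moreover have "(r, c) \<in> S" if rc: "(r, c) \<in> Pi_roots n" "r < i" "c < n - m" for r c
  proof (rule ccontr)
    assume "(r, c) \<notin> S"
    then have "r \<in> M" "c = n - r" using rc by (auto simp: Pi_roots_def M_def)
    then show False using max[of r] rc by linarith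
  qed
  then have "corner_filled n S (i, n - m)"
    by (auto simp: corner_filled_def)
  moreover have "(i, n - m) \<in> roots n" "n + 1 \<le> i + (n - m)"
    using m lt assms by (auto simp: roots_def)
  ultimately have "(i, n - m) \<in> L_zero n S"
    using assms(1,2) by (simp add: L_zero_def)
  then show thesis by (rule that)
qed

section \<open>Nonzero boxes and the monomial shape of the corner block\<close>

lemma lambda_coeff_nonzero_cases:
  assumes "lambda_coeff n lam S a (i, j) \<noteq> 0"
  obtains (Pi_zero) "j = i + 1" "1 \<le> i" "i \<le> half n" "j \<noteq> n - i"
    | (S) "(i, j) \<in> S"
    | (zero) "(i, j) \<in> L_zero n S"
    | (zerozero) "(i, j) \<in> L_zerozero n S"
    | (minus) "(i, j) \<in> L_minus n S"
  using assms by (auto simp: lambda_coeff_def Pi_zero_def Pi_roots_def split: if_splits)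

lemma Pi_subset_D:
  assumes "(i, j) \<in> S" "S \<subseteq> Pi_roots n"
  shows "1 \<le> i" "i \<le> half n" "j = n - i"
  using assms by (auto simp: Pi_roots_def)

text \<open>The remaining boxes miss the block: those of \<open>L_minus\<close> lie in rows from
  \<open>n - half n\<close> on, and those of \<open>Pi_zero\<close> lie too far left, except for
  \<open>(half n, half n + 1)\<close> with \<open>n\<close> odd, which belongs to
  \<open>Pi_roots n\<close>.\<close>

lemma corner_cases:
  assumes n: "n > 2" and S: "S \<subseteq> Pi_roots n" and nz: "lambda_coeff n lam S a (i, j) \<noteq> 0"
    and ij: "i \<le> n - 1 - half n" "n - half n \<le> j"
  shows "(i, j) \<in> S \<or> (i, j) \<in> L_zero n S \<union> L_zerozero n S"
  using nz
proof (cases rule: lambda_coeff_nonzero_cases)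
  case Pi_zero
  then show ?thesis using ij half_cases[OF n] by auto
next
  case minus
  then obtain l i0 where "i = n - l" "l < i0" "(i0, j) \<in> L_zero n S"
    using L_minus_E S by metis
  then have "n - half n \<le> i" using L_zero_D(2) by fastforce
  then show ?thesis using ij half_cases[OF n] by linarith
qed auto

lemma L_zero_zerozero_D:
  assumes n: "n > 2" and L: "(i, j) \<in> L_zero n S \<union> L_zerozero n S"
  shows "1 \<le> i" "i \<le> half n + 1" "j \<le> n" "n + 1 \<le> i + j" "(i, m) \<notin> S" "(m, j) \<notin> S"
    "1 \<le> l \<Longrightarrow> l < i \<Longrightarrow> n - l < j \<Longrightarrow> (l, n - l) \<in> S"
proof -
  consider "(i, j) \<in> L_zero n S" | "(i, j) \<in> L_zerozero n S" using L by blast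
  then have "1 \<le> i \<and> i \<le> half n + 1 \<and> j \<le> n \<and> n + 1 \<le> i + j \<and> (i, m) \<notin> S \<and> (m, j) \<notin> S \<and>
      (1 \<le> l \<longrightarrow> l < i \<longrightarrow> n - l < j \<longrightarrow> (l, n - l) \<in> S)"
  proof cases
    case 1
    note D = L_zero_D[OF 1]
    from D(1-7) D(8)[of l] show ?thesis by simp
  next
    case 2
    note D = L_zerozero_D[OF 2]
    \<comment> \<open>Here \<open>n\<close> is even and \<open>i = half n + 1 = n / 2\<close>, so
      \<open>i < j\<close> already gives the inequality.\<close>
    have "n + 1 \<le> i + j" using D(1,2,4) half_cases[OF n] by linarith
    with D(2-6) D(7)[of l] show ?thesis by simp
  qed
  then show "1 \<le> i" "i \<le> half n + 1" "j \<le> n" "n + 1 \<le> i + j" "(i, m) \<notin> S" "(m, j) \<notin> S"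
    "1 \<le> l \<Longrightarrow> l < i \<Longrightarrow> n - l < j \<Longrightarrow> (l, n - l) \<in> S" by blast+
qed

text \<open>If \<open>j' < j\<close>, the root \<open>(n - j', j')\<close> lies strictly above and
  to the left of \<open>(i, j)\<close>, hence in \<open>S\<close>; but column \<open>j'\<close> is
  free of \<open>S\<close>.\<close>

lemma L_row_unique:
  assumes n: "n > 2"
    and L: "(i, j) \<in> L_zero n S \<union> L_zerozero n S" "(i, j') \<in> L_zero n S \<union> L_zerozero n S"
  shows "j \<le> j'"
proof (rule ccontr)
  assume "\<not> j \<le> j'"
  note D = L_zero_zerozero_D[OF n L(1)] and D' = L_zero_zerozero_D[OF n L(2)]
  have "1 \<le> n - j'" "n - j' < i" "n - (n - j') = j'"
    using \<open>\<not> j \<le> j'\<close> D(3) D'(1,3,4) by linarith+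
  then have "(n - j', j') \<in> S"
    using D(7)[of "n - j'"] \<open>\<not> j \<le> j'\<close> by simp
  then show False using D'(6) by blast
qed

text \<open>If \<open>i' < i\<close>, the root \<open>(i', n - i')\<close> lies strictly above and
  to the left of \<open>(i, j)\<close>, hence in \<open>S\<close>; but row \<open>i'\<close> is free
  of \<open>S\<close>.\<close>

lemma L_col_unique:
  assumes n: "n > 2"
    and L: "(i, j) \<in> L_zero n S \<union> L_zerozero n S" "(i', j) \<in> L_zero n S \<union> L_zerozero n S"
  shows "i \<le> i'"
proof (rule ccontr)
  assume "\<not> i \<le> i'"
  note D = L_zero_zerozero_D[OF n L(1)] and D' = L_zero_zerozero_D[OF n L(2)]
  have "n - i' < j"
    using \<open>\<not> i \<le> i'\<close> D(2) D'(4) half_cases[OF n] by linarith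
  then have "(i', n - i') \<in> S"
    using D(7)[of i'] D'(1) \<open>\<not> i \<le> i'\<close> by simp
  then show False using D'(5) by blast
qed

lemma corner_row_unique:
  assumes n: "n > 2" and S: "S \<subseteq> Pi_roots n"
    and nz: "lambda_coeff n lam S a (i, j) \<noteq> 0" "lambda_coeff n lam S a (i, j') \<noteq> 0"
    and ij: "i \<le> n - 1 - half n" "n - half n \<le> j" "n - half n \<le> j'"
  shows "j = j'"
proof -
  note c = corner_cases[OF n S nz(1) ij(1,2)] corner_cases[OF n S nz(2) ij(1,3)]
  have "j = j'" if "(i, j) \<in> L_zero n S \<union> L_zerozero n S" "(i, j') \<in> L_zero n S \<union> L_zerozero n S"
    using L_row_unique[OF n that] L_row_unique[OF n that(2,1)] by simp
  then show ?thesis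
    using c Pi_subset_D(3)[OF _ S] L_zero_D(6) L_zerozero_D(5) by blast
qed

lemma corner_col_unique:
  assumes n: "n > 2" and S: "S \<subseteq> Pi_roots n"
    and nz: "lambda_coeff n lam S a (i, j) \<noteq> 0" "lambda_coeff n lam S a (i', j) \<noteq> 0"
    and ij: "i \<le> n - 1 - half n" "i' \<le> n - 1 - half n" "n - half n \<le> j"
  shows "i = i'"
proof -
  note c = corner_cases[OF n S nz(1) ij(1,3)] corner_cases[OF n S nz(2) ij(2,3)]
  have 1: "i = i'" if "(i, j) \<in> L_zero n S \<union> L_zerozero n S" "(i', j) \<in> L_zero n S \<union> L_zerozero n S"
    using L_col_unique[OF n that] L_col_unique[OF n that(2,1)] by simp
  have 2: "i = i'" if "(i, j) \<in> S" "(i', j) \<in> S"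
    using Pi_subset_D[OF that(1) S] Pi_subset_D[OF that(2) S] half_cases[OF n] by auto
  show ?thesis
    using c 1 2 L_zero_D(7) L_zerozero_D(6) by blast
qed

section \<open>Recovering \<open>S\<close> from the corner block\<close>

lemma lambda_coeff_L_zero_nonzero:
  assumes n: "n > 2" and S: "S \<subseteq> Pi_roots n" and a: "a \<in> Lambda_set n S"
    and L: "(i, j) \<in> L_zero n S"
  shows "lambda_coeff n lam S a (i, j) \<noteq> 0"
proof -
  have "(i, j) \<notin> Pi_zero n"
    using L_zero_D(2,4)[OF L] half_cases[OF n] by (auto simp: Pi_zero_def)
  then show ?thesis
    using a L L_zero_D(6)[OF L] by (auto simp: lambda_coeff_def Lambda_set_def)
qed

text \<open>A row \<open>i\<close> with its root in \<open>S\<close> but not in \<open>S'\<close>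
  has a box of \<open>L_zero n S'\<close>, where the second form is nonzero. In the block, row
  \<open>i\<close> of the first form is nonzero at most at the root of \<open>S\<close>, which lies
  further left.\<close>

lemma support_subset:
  assumes n: "n > 2" and S: "S \<subseteq> Pi_roots n" and S': "S' \<subseteq> Pi_roots n"
    and a': "a' \<in> Lambda_set n S'"
    and corner: "\<And>i j. 1 \<le> i \<Longrightarrow> i \<le> n - 1 - half n \<Longrightarrow> n - half n \<le> j \<Longrightarrow> j \<le> n \<Longrightarrow>
      lambda_coeff n lam S' a' (i, j) = lambda_coeff n lam S a (i, j)"
  shows "S \<subseteq> S'"
proof
  fix \<gamma> assume \<gamma>: "\<gamma> \<in> S"
  then obtain i where i: "\<gamma> = (i, n - i)" "1 \<le> i" "i \<le> half n"
    using S by (auto simp: Pi_roots_def)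
  show "\<gamma> \<in> S'"
  proof (rule ccontr)
    assume "\<gamma> \<notin> S'"
    then obtain j where j: "(i, j) \<in> L_zero n S'"
      using L_zero_exists i S' by metis
    note D = L_zero_D[OF j]
    have b: "i \<le> n - 1 - half n" "n - half n \<le> j"
      using D half_cases[OF n] by auto
    have "lambda_coeff n lam S a (i, j) \<noteq> 0"
      using lambda_coeff_L_zero_nonzero[OF n S' a' j, of lam] corner[OF i(2) b D(3)] by simp
    then consider "(i, j) \<in> S" | "(i, j) \<in> L_zero n S \<union> L_zerozero n S"
      using corner_cases[OF n S _ b] by blast
    then show False
    proof cases
      case 1
      then show False using Pi_subset_D(3)[OF 1 S] D(2,4) half_cases[OF n] by auto
    next
      case 2
      then show False using \<gamma> i L_zero_D(6) L_zerozero_D(5) by blast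
    qed
  qed
qed

text \<open>Above row \<open>n - i\<close>, the support in column \<open>J\<close> can only meet row
  \<open>i0\<close> and rows \<open>n - m\<close> with \<open>m > i\<close>. For such a row index
  \<open>q\<close>, column \<open>q\<close> of \<open>F'\<close> is zero above row \<open>i\<close>,
  so the equation at \<open>(i, q)\<close> isolates \<open>h (n - i) q\<close>.\<close>

lemma L_minus_agree:
  fixes lam :: "'a::field mat \<Rightarrow> 'a"
  assumes n: "n > 2" and S: "S \<subseteq> Pi_roots n" and nd: "nondegenerate n lam"
    and L: "(r, J) \<in> L_minus n S"
    and eq: "\<And>i j. (i, j) \<in> roots n \<Longrightarrow>
      lambda_coeff n lam S a' (i, j) + (\<Sum>l\<in>{1..<i}. h i l * lambda_coeff n lam S a' (l, j)) =
      lambda_coeff n lam S a (i, j) + (\<Sum>l\<in>{j<..n}. lambda_coeff n lam S a (i, l) * h l j)"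
  shows "lambda_coeff n lam S a' (r, J) = lambda_coeff n lam S a (r, J)"
proof -
  define F where "F = lambda_coeff n lam S a"
  define F' where "F' = lambda_coeff n lam S a'"
  obtain i i0 where r: "r = n - i" and i: "1 \<le> i" "i < i0" "(i0, J) \<in> L_zero n S" "n + 1 \<le> i + J" "(i, n - i) \<in> S"
    using L_minus_E[OF L S] by metis
  note D = L_zero_D[OF i(3)]
  note hn = half_cases[OF n]
  have F_d: "F (i, n - i) \<noteq> 0"
  proof -
    \<comment> \<open>\<open>Pi_roots n\<close> and \<open>Pi_zero n\<close> can meet only in row
      \<open>half n\<close>, and \<open>i < i0 <= half n\<close>.\<close>
    have "(i, n - i) \<notin> Pi_zero n" using D(2) i hn by (auto simp: Pi_zero_def)
    then show ?thesis using nd i(5) S by (auto simp: nondegenerate_def F_def lambda_coeff_def)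
  qed
  have F_row_i: "q = i + 1 \<or> q = n - i" if "F (i, q) \<noteq> 0" for q
    using that[unfolded F_def]
  proof (cases rule: lambda_coeff_nonzero_cases)
    case S
    then show ?thesis using Pi_subset_D(3) \<open>S \<subseteq> Pi_roots n\<close> by blast
  next
    case zero
    then show ?thesis using L_zero_D(6) i(5) by blast
  next
    case zerozero
    then show ?thesis using L_zerozero_D(5) i(5) by blast
  next
    case minus
    then obtain l l0 where l: "i = n - l" "l < l0" "(l0, q) \<in> L_zero n S"
      using L_minus_E S by metis
    then show ?thesis using L_zero_D(2)[OF l(3)] D(2) i hn by auto
  qed auto
  \<comment> \<open>Row \<open>i\<close> carries no parameter, because it contains a root of
    \<open>S\<close> and lies above all rows of \<open>L_minus\<close>.\<close>
  have F'_row_i: "F' (i, q) = F (i, q)" if "q \<noteq> n - i" for q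
  proof (cases "(i, q) \<in> (Pi_zero n - Pi_roots n) \<union> S")
    case True
    then show ?thesis by (simp add: F_def F'_def lambda_coeff_def)
  next
    case False
    have "(i, q) \<notin> L_zero n S \<union> L_zerozero n S \<union> L_minus n S"
    proof
      assume "(i, q) \<in> L_zero n S \<union> L_zerozero n S \<union> L_minus n S"
      then consider "(i, q) \<in> L_zero n S" | "(i, q) \<in> L_zerozero n S" | "(i, q) \<in> L_minus n S" by blast
      then show False
      proof cases
        case 1
        then show False using L_zero_D(6) i(5) by blast
      next
        case 2
        then show False using L_zerozero_D(5) i(5) by blast
      next
        case 3
        then obtain l l0 where l: "i = n - l" "l < l0" "(l0, q) \<in> L_zero n S"
          using L_minus_E S by metis
        then show False using L_zero_D(2)[OF l(3)] D(2) i hn by auto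
      qed
    qed
    with False show ?thesis by (auto simp: F_def F'_def lambda_coeff_def)
  qed
  have h0: "h (n - i) q = 0" if q: "i < q" "q < n - i" and c: "\<And>l. 1 \<le> l \<Longrightarrow> l < i \<Longrightarrow> F' (l, q) = 0" for q
  proof -
    \<comment> \<open>As \<open>l > q > i\<close>, the possible entry in column \<open>i + 1\<close>
      is out of range and only \<open>l = n - i\<close> is left.\<close>
    have "(\<Sum>l\<in>{q<..n}. F (i, l) * h l q) = (\<Sum>l\<in>{n - i}. F (i, l) * h l q)"
      using F_row_i q by (intro sum.mono_neutral_right) force+
    moreover have "(i, q) \<in> roots n" using q i by (auto simp: roots_def)
    ultimately have "F' (i, q) = F (i, q) + F (i, n - i) * h (n - i) q"
      using eq[of i q] c by (simp add: F_def[symmetric] F'_def[symmetric])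
    then show ?thesis using F'_row_i[of q] q F_d by simp
  qed
  have F_row_r: "F (n - i, l) = 0" if "J < l" "l \<le> n" for l
  proof (rule ccontr)
    assume "F (n - i, l) \<noteq> 0"
    then show False
      unfolding F_def
    proof (cases rule: lambda_coeff_nonzero_cases)
      case Pi_zero
      then show False using D(2) i hn by auto
    next
      case S
      then show False using Pi_subset_D(2)[OF S \<open>S \<subseteq> Pi_roots n\<close>] D(2) i hn by auto
    next
      case zero
      then show False using L_zero_D(2)[OF zero] D(2) i hn by auto
    next
      case zerozero
      then show False using L_zerozero_D(2)[OF zerozero] D(2) i hn by auto
    next
      case minus
      then obtain m m0 where m: "n - i = n - m" "m < m0" "(m0, l) \<in> L_zero n S"
        using L_minus_E S by metis
      note D' = L_zero_D[OF m(3)]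
      have "m = i" using m D'(2) D(2) i hn by auto
      \<comment> \<open>The root \<open>(n - J, J)\<close> lies strictly above and to the left of
        \<open>(m0, l)\<close>, so it is in \<open>S\<close>, whereas column \<open>J\<close> must
        be free of \<open>S\<close>.\<close>
      then have "(n - J, J) \<in> S"
        using D'(8)[of "n - J"] D'(2) m i D(2,3) that hn by simp
      then show False using D(7) by blast
    qed
  qed
  have F'_col_J: "h (n - i) q * F' (q, J) = 0" if q: "1 \<le> q" "q < n - i" for q
  proof (cases "F' (q, J) = 0")
    case False
    have "i < q \<and> (\<forall>l. 1 \<le> l \<longrightarrow> l < i \<longrightarrow> F' (l, q) = 0)"
      using False[unfolded F'_def]
    proof (cases rule: lambda_coeff_nonzero_cases)
      case Pi_zero
      then show ?thesis using D(2,4) hn by auto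
    next
      case S
      then show ?thesis using D(7) by blast
    next
      case zero
      then have "q = i0"
        using L_col_unique[OF n, of q J S i0] L_col_unique[OF n, of i0 J S q] i(3) by auto
      \<comment> \<open>Now \<open>i0\<close> serves as a column index. Since it is at most
        \<open>half n\<close>, the only candidate above row \<open>i\<close> is a box of
        \<open>Pi_zero\<close>, and that sits in row \<open>i0 - 1 >= i\<close>.\<close>
      moreover have "F' (l, i0) = 0" if "1 \<le> l" "l < i" for l
      proof (rule ccontr)
        assume "F' (l, i0) \<noteq> 0"
        then show False
          unfolding F'_def
        proof (cases rule: lambda_coeff_nonzero_cases)
          case Pi_zero
          then show False using that i by auto
        next
          case S
          then show False using Pi_subset_D(3)[OF S \<open>S \<subseteq> Pi_roots n\<close>] that i D(2) hn by auto
        next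
          case zero
          then show False using L_zero_D(4)[OF zero] that i D(2) hn by auto
        next
          case zerozero
          then show False using L_zerozero_D(2)[OF zerozero] that i D(2) hn by auto
        next
          case minus
          then obtain m m0 where m: "m < m0" "(m0, i0) \<in> L_zero n S"
            using L_minus_E S by metis
          then show False using L_zero_D(2,4)[OF m(2)] D(2) hn by auto
        qed
      qed
      ultimately show ?thesis using i by auto
    next
      case zerozero
      then have "q \<le> i0"
        using L_col_unique[OF n, of q J S i0] i(3) by auto
      then show ?thesis using L_zerozero_D(2)[OF zerozero] D(2) by auto
    next
      case minus
      then obtain m m0 where m: "q = n - m" "1 \<le> m" "(m, n - m) \<in> S"
        using L_minus_E S by metis
      have mh: "m \<le> half n" using Pi_subset_D(2)[OF m(3) S] .
      have im: "i < m" using m q by auto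
      \<comment> \<open>The root \<open>(m, n - m)\<close> of \<open>S\<close> occupies column
        \<open>q\<close>. It excludes boxes of \<open>L_zero\<close> and \<open>L_zerozero\<close>,
        and also of \<open>L_minus\<close>, which share columns with \<open>L_zero\<close>; its own
        row \<open>m\<close> lies below row \<open>i\<close>.\<close>
      have "F' (l, q) = 0" if "1 \<le> l" "l < i" for l
      proof (rule ccontr)
        assume "F' (l, q) \<noteq> 0"
        then show False
          unfolding F'_def
        proof (cases rule: lambda_coeff_nonzero_cases)
          case Pi_zero
          then show False using that m mh im hn by auto
        next
          case S
          then show False using Pi_subset_D[OF S \<open>S \<subseteq> Pi_roots n\<close>] that m mh im hn by auto
        next
          case zero
          then show False using L_zero_D(7) m by blast
        next
          case zerozero
          then show False using L_zerozero_D(6) m by blast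
        next
          case minus
          then obtain m0 where "(m0, q) \<in> L_zero n S"
            using L_minus_E S by metis
          then show False using L_zero_D(7) m by blast
        qed
      qed
      then show ?thesis using m mh im D(2) i hn by auto
    qed
    then show ?thesis using h0[of q] q by simp
  qed simp
  have "(n - i, J) \<in> roots n"
    using i D(2,3) hn by (auto simp: roots_def)
  \<comment> \<open>In the equation at \<open>(n - i, J)\<close> every summand on either side
    vanishes.\<close>
  from eq[OF this] show ?thesis
    using F'_col_J F_row_r by (simp add: r F_def[symmetric] F'_def[symmetric])
qed

section \<open>Comparison of two forms in one orbit, first on the corner block and then box by
  box\<close>

theorem theorem3p5:
  fixes n :: nat
    and lam :: "'a::{finite, field} mat \<Rightarrow> 'a"
    and S S' :: "(nat \<times> nat) set"
    and a a' :: "nat \<times> nat \<Rightarrow> 'a"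
  assumes "n > 2"
    and "lam \<in> characters n (g_plus n)"
    and "nondegenerate n lam"
    and "S \<subseteq> Pi_roots n" and "S' \<subseteq> Pi_roots n"
    and "a \<in> Lambda_set n S" and "a' \<in> Lambda_set n S'"
  shows "(\<exists>\<Omega> \<in> coadjoint_orbits n. lambda_form n lam S a \<in> \<Omega> \<and> lambda_form n lam S' a' \<in> \<Omega>)
         \<longleftrightarrow> lambda_form n lam S a = lambda_form n lam S' a'"
proof
  assume "lambda_form n lam S a = lambda_form n lam S' a'"
  then show "\<exists>\<Omega> \<in> coadjoint_orbits n. lambda_form n lam S a \<in> \<Omega> \<and> lambda_form n lam S' a' \<in> \<Omega>"
    using coad_self_orbit[OF root_form_linear] by (metis lambda_form_eq_root_form)
next
  note n = assms(1) and nd = assms(3) and S = assms(4) and S' = assms(5)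
  define F where "F = lambda_coeff n lam S a"
  define F' where "F' = lambda_coeff n lam S' a'"
  assume "\<exists>\<Omega> \<in> coadjoint_orbits n. lambda_form n lam S a \<in> \<Omega> \<and> lambda_form n lam S' a' \<in> \<Omega>"
  then obtain h where eq: "\<And>i j. (i, j) \<in> roots n \<Longrightarrow>
      F' (i, j) + (\<Sum>l\<in>{1..<i}. h i l * F' (l, j)) = F (i, j) + (\<Sum>l\<in>{j<..n}. F (i, l) * h l j)"
    using root_forms_common_orbit[of _ n F F'] unfolding lambda_form_eq_root_form F_def F'_def by blast
  \<comment> \<open>The row bound is \<open>half n\<close> for odd \<open>n\<close> and
    \<open>half n + 1\<close> for even \<open>n\<close>, so the block contains \<open>L_zero\<close>
    and, when it is nonempty, \<open>L_zerozero\<close>. All boxes of the block are roots, as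
    \<open>n - 1 - half n < n - half n\<close>.\<close>
  have corner: "F' (i, j) = F (i, j)"
    if "1 \<le> i" "i \<le> n - 1 - half n" "n - half n \<le> j" "j \<le> n" for i j
  proof (rule monomial_corner_unique[OF _ _ _ _ _ that])
    fix i j
    assume "1 \<le> i" "i \<le> n - 1 - half n" "n - half n \<le> j" "j \<le> n"
    then show "F' (i, j) + (\<Sum>l\<in>{1..<i}. h i l * F' (l, j)) = F (i, j) + (\<Sum>l\<in>{j<..n}. F (i, l) * h l j)"
      using n by (intro eq) (auto simp: roots_def half_def)
  qed (use corner_row_unique[OF n S] corner_col_unique[OF n S]
         corner_row_unique[OF n S'] corner_col_unique[OF n S'] in \<open>auto simp: F_def F'_def\<close>)
  have SS': "S' = S"
    using support_subset[OF n S S' assms(7)] support_subset[OF n S' S assms(6)] corner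
    unfolding F_def F'_def by (metis subset_antisym)
  have "F' (i, j) = F (i, j)" if ij: "(i, j) \<in> roots n" for i j
  proof -
    have hn: "n = 2 * half n + 1 \<or> n = 2 * half n + 2" using half_cases[OF n] by auto
    consider "(i, j) \<in> (Pi_zero n - Pi_roots n) \<union> S" | "(i, j) \<in> L_zero n S" | "(i, j) \<in> L_zerozero n S"
      | "(i, j) \<in> L_minus n S" | "(i, j) \<notin> (Pi_zero n - Pi_roots n) \<union> S \<union> L_zero n S \<union> L_zerozero n S \<union> L_minus n S"
      by blast
    then show ?thesis
    proof cases
      case 1
      then show ?thesis by (simp add: F_def F'_def SS' lambda_coeff_def)
    next
      case 2
      then show ?thesis using corner[of i j] L_zero_D(1-4)[OF 2] hn by auto
    next
      case 3
      then show ?thesis using corner[of i j] L_zerozero_D(1-4)[OF 3] half_cases[OF n] by auto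
    next
      case 4
      then show ?thesis
        using L_minus_agree[OF n S nd 4, of a' h a] eq by (simp add: F_def F'_def SS')
    next
      case 5
      then show ?thesis by (auto simp: F_def F'_def SS' lambda_coeff_def)
    qed
  qed
  then show "lambda_form n lam S a = lambda_form n lam S' a'"
    unfolding lambda_form_eq_root_form F_def F'_def by (intro root_form_cong) simp
qed

end
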